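(* In first-order predicate calculus with equality, without any axioms of set theory, $AC^* \rightarrow AC$, where $$AC^* \equiv \forall x (AC_h^*(x) \rightarrow \exists y (y \notin x \wedge C(y,x)))$$ and $$AC \equiv \forall x [AC_{h,1}(x) \wedge AC_{h,2}(x) \rightarrow \exists y\, C(y,x)].$$
   Context: The language is first-order predicate calculus with equality and one binary relation symbol $\in$. $z \neq \emptyset$ abbreviates $\exists b\, b \in z$, and $z \cap z' = \emptyset$ abbreviates $\neg\exists a (a \in z \wedge a \in z')$. $C(y,x)$ ("$y$ is a choice-set for $x$") is $$\forall z \in x\, (\exists b\, b \in z \rightarrow \exists a (a \in z \wedge a \in y \wedge \forall b (b \in z \wedge b \in y \rightarrow b = a))).$$ $AC_{h,1}(x) \equiv \forall z \in x\; z \neq \emptyset$. $AC_{h,2}(x) \equiv \forall z, z' \in x\, (z \neq z' \rightarrow z \cap z' = \emptyset)$. $AC_h^*(x) \equiv \forall z \in x\, \exists a \in z\, \forall z' \in x\, (z \neq z' \rightarrow a \notin z')$. *)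

theory Defs
  imports Main
begin

text \<open>
  First-order predicate calculus with equality, classical, for the language whose only
  non-logical symbol is a binary relation symbol. There are no function symbols, so the terms
  are exactly the variables. Negation is \<open>\<phi> \<rightarrow> \<bottom>\<close>.
\<close>

type_synonym var = nat

datatype fm =
    Mem var var      (infix \<open>\<^bold>\<in>\<close> 60)
  | Eq var var       (infix \<open>\<^bold>=\<close> 60)
  | Fls              (\<open>\<^bold>\<bottom>\<close>)
  | Con fm fm        (infixr \<open>\<^bold>\<and>\<close> 45)
  | Dis fm fm        (infixr \<open>\<^bold>\<or>\<close> 40)
  | Imp fm fm        (infixr \<open>\<^bold>\<longrightarrow>\<close> 35)
  | All var fm
  | Ex var fm

abbreviation Neg :: "fm \<Rightarrow> fm" (\<open>\<^bold>\<not> _\<close> [50] 50) where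
  "\<^bold>\<not> p \<equiv> p \<^bold>\<longrightarrow> \<^bold>\<bottom>"

primrec fv :: "fm \<Rightarrow> var set" where
  "fv (u \<^bold>\<in> v) = {u, v}"
| "fv (u \<^bold>= v) = {u, v}"
| "fv \<^bold>\<bottom> = {}"
| "fv (p \<^bold>\<and> q) = fv p \<union> fv q"
| "fv (p \<^bold>\<or> q) = fv p \<union> fv q"
| "fv (p \<^bold>\<longrightarrow> q) = fv p \<union> fv q"
| "fv (All x p) = fv p - {x}"
| "fv (Ex x p) = fv p - {x}"

text \<open>
  \<open>subst x t p\<close> replaces the free occurrences of \<open>x\<close> in \<open>p\<close> by \<open>t\<close>. It does not rename bound
  variables; \<open>free_for t x p\<close> says that no occurrence of \<open>t\<close> so introduced becomes bound.
\<close>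

primrec subst :: "var \<Rightarrow> var \<Rightarrow> fm \<Rightarrow> fm" where
  "subst x t (u \<^bold>\<in> v) = ((if u = x then t else u) \<^bold>\<in> (if v = x then t else v))"
| "subst x t (u \<^bold>= v) = ((if u = x then t else u) \<^bold>= (if v = x then t else v))"
| "subst x t \<^bold>\<bottom> = \<^bold>\<bottom>"
| "subst x t (p \<^bold>\<and> q) = (subst x t p \<^bold>\<and> subst x t q)"
| "subst x t (p \<^bold>\<or> q) = (subst x t p \<^bold>\<or> subst x t q)"
| "subst x t (p \<^bold>\<longrightarrow> q) = (subst x t p \<^bold>\<longrightarrow> subst x t q)"
| "subst x t (All z p) = All z (if z = x then p else subst x t p)"
| "subst x t (Ex z p) = Ex z (if z = x then p else subst x t p)"

primrec free_for :: "var \<Rightarrow> var \<Rightarrow> fm \<Rightarrow> bool" where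
  "free_for t x (u \<^bold>\<in> v) \<longleftrightarrow> True"
| "free_for t x (u \<^bold>= v) \<longleftrightarrow> True"
| "free_for t x \<^bold>\<bottom> \<longleftrightarrow> True"
| "free_for t x (p \<^bold>\<and> q) \<longleftrightarrow> free_for t x p \<and> free_for t x q"
| "free_for t x (p \<^bold>\<or> q) \<longleftrightarrow> free_for t x p \<and> free_for t x q"
| "free_for t x (p \<^bold>\<longrightarrow> q) \<longleftrightarrow> free_for t x p \<and> free_for t x q"
| "free_for t x (All z p) \<longleftrightarrow> x \<notin> fv (All z p) \<or> (z \<noteq> t \<and> free_for t x p)"
| "free_for t x (Ex z p) \<longleftrightarrow> x \<notin> fv (Ex z p) \<or> (z \<noteq> t \<and> free_for t x p)"

text \<open>Natural deduction. The set on the left consists of the open assumptions.\<close>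

inductive derivable :: "fm set \<Rightarrow> fm \<Rightarrow> bool" (infix \<open>\<turnstile>\<close> 30) where
  Assm: "p \<in> G \<Longrightarrow> G \<turnstile> p"
| RAA: "insert (\<^bold>\<not> p) G \<turnstile> \<^bold>\<bottom> \<Longrightarrow> G \<turnstile> p"
| ConI: "G \<turnstile> p \<Longrightarrow> G \<turnstile> q \<Longrightarrow> G \<turnstile> p \<^bold>\<and> q"
| ConE1: "G \<turnstile> p \<^bold>\<and> q \<Longrightarrow> G \<turnstile> p"
| ConE2: "G \<turnstile> p \<^bold>\<and> q \<Longrightarrow> G \<turnstile> q"
| DisI1: "G \<turnstile> p \<Longrightarrow> G \<turnstile> p \<^bold>\<or> q"
| DisI2: "G \<turnstile> q \<Longrightarrow> G \<turnstile> p \<^bold>\<or> q"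
| DisE: "G \<turnstile> p \<^bold>\<or> q \<Longrightarrow> insert p G \<turnstile> r \<Longrightarrow> insert q G \<turnstile> r \<Longrightarrow> G \<turnstile> r"
| ImpI: "insert p G \<turnstile> q \<Longrightarrow> G \<turnstile> p \<^bold>\<longrightarrow> q"
| ImpE: "G \<turnstile> p \<^bold>\<longrightarrow> q \<Longrightarrow> G \<turnstile> p \<Longrightarrow> G \<turnstile> q"
| AllI: "G \<turnstile> p \<Longrightarrow> \<forall>g\<in>G. x \<notin> fv g \<Longrightarrow> G \<turnstile> All x p"
| AllE: "G \<turnstile> All x p \<Longrightarrow> free_for t x p \<Longrightarrow> G \<turnstile> subst x t p"
| ExI: "G \<turnstile> subst x t p \<Longrightarrow> free_for t x p \<Longrightarrow> G \<turnstile> Ex x p"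
| ExE: "G \<turnstile> Ex x p \<Longrightarrow> insert p G \<turnstile> q \<Longrightarrow> \<forall>g\<in>G. x \<notin> fv g \<Longrightarrow> x \<notin> fv q \<Longrightarrow> G \<turnstile> q"
| EqRefl: "G \<turnstile> u \<^bold>= u"
| EqSubst: "G \<turnstile> u \<^bold>= v \<Longrightarrow> G \<turnstile> subst x u p \<Longrightarrow> free_for u x p \<Longrightarrow> free_for v x p \<Longrightarrow>
    G \<turnstile> subst x v p"

abbreviation All_in :: "var \<Rightarrow> var \<Rightarrow> fm \<Rightarrow> fm" where
  "All_in u v p \<equiv> All u (u \<^bold>\<in> v \<^bold>\<longrightarrow> p)"

abbreviation Ex_in :: "var \<Rightarrow> var \<Rightarrow> fm \<Rightarrow> fm" where
  "Ex_in u v p \<equiv> Ex u (u \<^bold>\<in> v \<^bold>\<and> p)"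

text \<open>
  Six distinct variables. Names are not bound hygienically: the parameters of the formulas below
  are meant to be instantiated only with variables different from the ones bound in the body.
\<close>

abbreviation vx :: var where "vx \<equiv> 0"
abbreviation vy :: var where "vy \<equiv> 1"
abbreviation vz :: var where "vz \<equiv> 2"
abbreviation vz' :: var where "vz' \<equiv> 3"
abbreviation va :: var where "va \<equiv> 4"
abbreviation vb :: var where "vb \<equiv> 5"

definition nonempty :: "var \<Rightarrow> fm" where
  "nonempty z = Ex vb (vb \<^bold>\<in> z)"

definition disjoint :: "var \<Rightarrow> var \<Rightarrow> fm" where
  "disjoint z z' = (\<^bold>\<not> Ex va (va \<^bold>\<in> z \<^bold>\<and> va \<^bold>\<in> z'))"

definition choice_set :: "var \<Rightarrow> var \<Rightarrow> fm" where
  "choice_set y x =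
    All_in vz x (Ex vb (vb \<^bold>\<in> vz) \<^bold>\<longrightarrow>
      Ex va (va \<^bold>\<in> vz \<^bold>\<and> va \<^bold>\<in> y \<^bold>\<and> All vb (vb \<^bold>\<in> vz \<^bold>\<and> vb \<^bold>\<in> y \<^bold>\<longrightarrow> vb \<^bold>= va)))"

definition AC_h1 :: "var \<Rightarrow> fm" where
  "AC_h1 x = All_in vz x (nonempty vz)"

definition AC_h2 :: "var \<Rightarrow> fm" where
  "AC_h2 x = All_in vz x (All_in vz' x (\<^bold>\<not> (vz \<^bold>= vz') \<^bold>\<longrightarrow> disjoint vz vz'))"

definition AC_h_star :: "var \<Rightarrow> fm" where
  "AC_h_star x =
    All_in vz x (Ex_in va vz (All_in vz' x (\<^bold>\<not> (vz \<^bold>= vz') \<^bold>\<longrightarrow> \<^bold>\<not> (va \<^bold>\<in> vz'))))"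

definition AC_star :: fm where
  "AC_star = All vx (AC_h_star vx \<^bold>\<longrightarrow> Ex vy (\<^bold>\<not> (vy \<^bold>\<in> vx) \<^bold>\<and> choice_set vy vx))"

definition AC :: fm where
  "AC = All vx (AC_h1 vx \<^bold>\<and> AC_h2 vx \<^bold>\<longrightarrow> Ex vy (choice_set vy vx))"

end

theory Submission
  imports Defs
begin

text \<open>
  \<open>AC_h1\<close> and \<open>AC_h2\<close> imply \<open>AC_h_star\<close>: any element \<open>b\<close> of a nonempty \<open>z \<in> x\<close> serves as the
  witness \<open>a\<close>, since by disjointness it lies in no other member of \<open>x\<close>.
\<close>

lemma subst_same: "subst x x p = p"
  by (induction p) auto

text \<open>This survives quantifiers over \<open>x\<close> itself: there \<open>x\<close> is not
  free in the quantified formula, so the first disjunct of \<open>free_for\<close> applies.\<close>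

lemma free_for_same: "free_for x x p"
  by (induction p) auto

text \<open>Instantiating a bound variable by itself strips the quantifier with no renaming and no
  capture condition to check.\<close>

lemma AllE_same: "G \<turnstile> All x p \<Longrightarrow> G \<turnstile> p"
  using AllE[of G x p x] by (simp add: subst_same free_for_same)

lemma ExI_same: "G \<turnstile> p \<Longrightarrow> G \<turnstile> Ex x p"
  using ExI[of G x x p] by (simp add: subst_same free_for_same)

lemma All_inE_same: "G \<turnstile> All_in u v p \<Longrightarrow> G \<turnstile> u \<^bold>\<in> v \<Longrightarrow> G \<turnstile> p"
  by (rule ImpE[OF AllE_same])

lemma All_inI:
  "insert (u \<^bold>\<in> v) G \<turnstile> p \<Longrightarrow> \<forall>g\<in>G. u \<notin> fv g \<Longrightarrow> G \<turnstile> All_in u v p"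
  by (intro AllI ImpI)

lemmas fv_defs = AC_star_def AC_h_star_def AC_h1_def AC_h2_def nonempty_def disjoint_def
  choice_set_def

text \<open>The free variables \<open>vz\<close> and \<open>vz'\<close> are the very ones that
  \<open>AC_h2\<close> binds, so its quantifiers come off unrenamed. Then \<open>vb\<close>
  witnesses that the two sets meet, against \<open>disjoint\<close>.\<close>

lemma not_mem_of_disjoint:
  assumes "G \<turnstile> AC_h2 vx" "G \<turnstile> vz \<^bold>\<in> vx" "G \<turnstile> vz' \<^bold>\<in> vx" "G \<turnstile> \<^bold>\<not> (vz \<^bold>= vz')"
    and "G \<turnstile> vb \<^bold>\<in> vz" "G \<turnstile> vb \<^bold>\<in> vz'"
  shows "G \<turnstile> \<^bold>\<bottom>"
proof -
  have "G \<turnstile> \<^bold>\<not> (vz \<^bold>= vz') \<^bold>\<longrightarrow> disjoint vz vz'"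
    using assms(1-3) unfolding AC_h2_def by (blast intro: All_inE_same)
  then have "G \<turnstile> \<^bold>\<not> Ex va (va \<^bold>\<in> vz \<^bold>\<and> va \<^bold>\<in> vz')"
    using ImpE assms(4) unfolding disjoint_def by blast
  moreover have "G \<turnstile> Ex va (va \<^bold>\<in> vz \<^bold>\<and> va \<^bold>\<in> vz')"
    by (rule ExI[where t = vb]) (simp_all add: ConI assms)
  ultimately show ?thesis by (rule ImpE)
qed

text \<open>The bound on free variables in \<open>G\<close> secures the eigenvariable conditions for
  \<open>vz\<close>, \<open>vb\<close> and \<open>vz'\<close>, while \<open>G\<close> may still
  contain other assumptions such as the sentence \<open>AC_star\<close>.\<close>

lemma AC_h_star_of_AC_h:
  assumes "(AC_h1 vx \<^bold>\<and> AC_h2 vx) \<in> G" and fv_G: "\<forall>g\<in>G. fv g \<subseteq> {vx}"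
  shows "G \<turnstile> AC_h_star vx"
  unfolding AC_h_star_def
proof (rule All_inI)
  let ?G = "insert (vz \<^bold>\<in> vx) G"
  let ?w = "All_in vz' vx (\<^bold>\<not> (vz \<^bold>= vz') \<^bold>\<longrightarrow> \<^bold>\<not> (va \<^bold>\<in> vz'))"
  have "?G \<turnstile> AC_h1 vx"
    using assms(1) by (blast intro: Assm ConE1)
  then have ex: "?G \<turnstile> Ex vb (vb \<^bold>\<in> vz)"
    unfolding AC_h1_def nonempty_def by (rule All_inE_same) (simp add: Assm)
  show "?G \<turnstile> Ex_in va vz ?w"
  proof (rule ExE[OF ex])
    let ?G' = "insert (vb \<^bold>\<in> vz) ?G"
    \<comment> \<open>This is \<open>?w\<close> with \<open>vb\<close> in place of
      \<open>va\<close>: the element supplied by \<open>AC_h1\<close> is named \<open>vb\<close>,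
      and \<open>ExI\<close> later turns it into the bound \<open>va\<close>. No capture occurs, as
      \<open>?w\<close> binds only \<open>vz'\<close>.\<close>
    have "?G' \<turnstile> All_in vz' vx (\<^bold>\<not> (vz \<^bold>= vz') \<^bold>\<longrightarrow> \<^bold>\<not> (vb \<^bold>\<in> vz'))"
    proof (intro All_inI ImpI)
      show "insert (vb \<^bold>\<in> vz') (insert (\<^bold>\<not> (vz \<^bold>= vz')) (insert (vz' \<^bold>\<in> vx) ?G')) \<turnstile> \<^bold>\<bottom>"
      proof (rule not_mem_of_disjoint)
        show "insert (vb \<^bold>\<in> vz') (insert (\<^bold>\<not> (vz \<^bold>= vz')) (insert (vz' \<^bold>\<in> vx) ?G')) \<turnstile> AC_h2 vx"
          using assms(1) by (blast intro: Assm ConE2)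
      qed (simp_all add: Assm)
      show "\<forall>g\<in>?G'. vz' \<notin> fv g" using fv_G by fastforce
    qed
    then have "?G' \<turnstile> subst va vb (va \<^bold>\<in> vz \<^bold>\<and> ?w)"
      by (simp add: ConI Assm)
    then show "?G' \<turnstile> Ex_in va vz ?w"
      by (rule ExI) simp
  qed (use fv_G in fastforce)+
qed (use fv_G in fastforce)+

theorem theorem3p4: "{} \<turnstile> AC_star \<^bold>\<longrightarrow> AC"
  unfolding AC_def
proof (intro ImpI AllI)
  \<comment> \<open>Generalising over \<open>vx\<close> is sound because the only assumption open at
    that point is the closed formula \<open>AC_star\<close>.\<close>
  let ?G = "{AC_h1 vx \<^bold>\<and> AC_h2 vx, AC_star}"
  have "?G \<turnstile> AC_star"
    by (simp add: Assm)
  then have "?G \<turnstile> AC_h_star vx \<^bold>\<longrightarrow> Ex vy (\<^bold>\<not> (vy \<^bold>\<in> vx) \<^bold>\<and> choice_set vy vx)"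
    unfolding AC_star_def by (rule AllE_same)
  moreover have "?G \<turnstile> AC_h_star vx"
    by (rule AC_h_star_of_AC_h) (auto simp: fv_defs)
  ultimately have ex: "?G \<turnstile> Ex vy (\<^bold>\<not> (vy \<^bold>\<in> vx) \<^bold>\<and> choice_set vy vx)"
    by (rule ImpE)
  show "?G \<turnstile> Ex vy (choice_set vy vx)"
  proof (rule ExE[OF ex])
    show "insert (\<^bold>\<not> (vy \<^bold>\<in> vx) \<^bold>\<and> choice_set vy vx) ?G \<turnstile> Ex vy (choice_set vy vx)"
      \<comment> \<open>The eigenvariable \<open>vy\<close> is its own witness; it is bound again in
        the goal, as \<open>ExE\<close> demands.\<close>
      by (rule ExI_same, rule ConE2, rule Assm, rule insertI1)
  qed (auto simp: fv_defs)
qed (auto simp: fv_defs)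

end
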